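(* Let $s\in(0,1/2)$, let $\mathcal{N}\subset\mathbb{R}^d$ be a compact smooth submanifold without boundary, let $\omega\subset\mathbb{R}$ be a bounded open interval, and let $\{u_n\}_{n\in\mathbb{N}}\subset\widehat H^s(\omega;\mathcal{N})$ be a sequence of minimizing $s$-harmonic maps in $\omega$. Assume that $\sup_n\mathcal{E}_s(u_n,\omega)<\infty$ and $u_n\to u$ in $L^2_{\rm loc}(\mathbb{R})$. Then $u\in\widehat H^s(\omega;\mathcal{N})$ is a minimizing $s$-harmonic map in $\omega$, $u_n\to u$ strongly in $H^s_{\rm loc}(\omega)$, and $\mathcal{E}_s(u_n,\omega')\to\mathcal{E}_s(u,\omega')$ for every open interval $\omega'$ with $\overline{\omega'}\subset\omega$.
   Context: For a bounded open interval $\omega\subset\mathbb{R}$ and a measurable $u:\mathbb{R}\to\mathbb{R}^d$, the fractional $s$-energy is $$\mathcal{E}_s(u,\omega):=\frac{\gamma_s}{2}\iint_{\omega\times\omega}\frac{|u(x)-u(y)|^2}{|x-y|^{1+2s}}\,dxdy+\gamma_s\iint_{\omega\times(\mathbb{R}\setminus\omega)}\frac{|u(x)-u(y)|^2}{|x-y|^{1+2s}}\,dxdy,$$ with $\gamma_s:=s2^{2s}\pi^{-1/2}\Gamma(\frac{1+2s}{2})/\Gamma(1-s)$. $\widehat H^s(\omega;\mathbb{R}^d)$ is the space of $u\in L^2_{\rm loc}(\mathbb{R};\mathbb{R}^d)$ with $\mathcal{E}_s(u,\omega)<\infty$, and $\widehat H^s(\omega;\mathcal{N})$ is the set of such $u$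 with $u(x)\in\mathcal{N}$ for a.e. $x\in\mathbb{R}$. A map $u\in\widehat H^s(\omega;\mathcal{N})$ is a minimizing $s$-harmonic map in $\omega$ if $\mathcal{E}_s(u,\omega)\le\mathcal{E}_s(\tilde u,\omega)$ for every $\tilde u\in\widehat H^s(\omega;\mathcal{N})$ with ${\rm spt}(\tilde u-u)\subset\omega$. Strong convergence in $H^s_{\rm loc}(\omega)$ means convergence in the Sobolev–Slobodeckij space $H^s(\omega')$ for every open interval $\omega'$ with $\overline{\omega'}\subset\omega$. *)

theory Defs
  imports "HOL-Analysis.Analysis"
begin

text \<open>A real-valued function is C-infinity on an open set U iff it is differentiable on U
  and all its partial derivatives (along the basis vectors) are again C-infinity on U.
  This is expressed coinductively (derivatives of all orders exist).\<close>

coinductive smooth_fun :: "'a::euclidean_space set \<Rightarrow> ('a \<Rightarrow> real) \<Rightarrow> bool"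
  for U :: "'a set" where
  "g differentiable_on U \<Longrightarrow>
   (\<forall>b\<in>Basis. smooth_fun U (\<lambda>x. frechet_derivative g (at x) b)) \<Longrightarrow>
   smooth_fun U g"

definition smooth_on :: "'a::euclidean_space set \<Rightarrow> ('a \<Rightarrow> 'b::euclidean_space) \<Rightarrow> bool" where
  "smooth_on U f \<longleftrightarrow> (\<forall>b\<in>Basis. smooth_fun U (\<lambda>x. f x \<bullet> b))"

definition smooth_submanifold :: "'a::euclidean_space set \<Rightarrow> bool" where
  "smooth_submanifold N \<longleftrightarrow>
     (\<exists>k. \<forall>p\<in>N. \<exists>U V (\<phi>::'a\<Rightarrow>'a) (\<psi>::'a\<Rightarrow>'a) (L::'a set).
        open U \<and> p \<in> U \<and> open V \<and>
        smooth_on U \<phi> \<and> smooth_on V \<psi> \<and>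
        \<phi> ` U = V \<and> (\<forall>x\<in>U. \<psi> (\<phi> x) = x) \<and> (\<forall>y\<in>V. \<phi> (\<psi> y) = y) \<and>
        subspace L \<and> dim L = k \<and> \<phi> ` (N \<inter> U) = V \<inter> L)"

definition gamma_s :: "real \<Rightarrow> real" where
  "gamma_s s = s * 2 powr (2 * s) * pi powr (-1/2) * Gamma ((1 + 2 * s) / 2) / Gamma (1 - s)"

definition frac_integrand :: "real \<Rightarrow> (real \<Rightarrow> 'a::real_normed_vector) \<Rightarrow> real \<times> real \<Rightarrow> ennreal" where
  "frac_integrand s u = (\<lambda>(x, y). ennreal (norm (u x - u y) ^ 2 / \<bar>x - y\<bar> powr (1 + 2 * s)))"

definition energy :: "real \<Rightarrow> (real \<Rightarrow> 'a::real_normed_vector) \<Rightarrow> real set \<Rightarrow> ennreal" where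
  "energy s u \<omega> =
     ennreal (gamma_s s / 2) * (\<integral>\<^sup>+ z \<in> \<omega> \<times> \<omega>. frac_integrand s u z \<partial>lebesgue)
   + ennreal (gamma_s s) * (\<integral>\<^sup>+ z \<in> \<omega> \<times> (UNIV - \<omega>). frac_integrand s u z \<partial>lebesgue)"

definition L2_loc :: "(real \<Rightarrow> 'a::euclidean_space) \<Rightarrow> bool" where
  "L2_loc u \<longleftrightarrow> u \<in> borel_measurable lebesgue \<and>
     (\<forall>a b. (\<integral>\<^sup>+ x \<in> {a..b}. ennreal (norm (u x) ^ 2) \<partial>lebesgue) < \<infinity>)"

definition L2_loc_conv :: "(nat \<Rightarrow> real \<Rightarrow> 'a::euclidean_space) \<Rightarrow> (real \<Rightarrow> 'a) \<Rightarrow> bool" where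
  "L2_loc_conv f u \<longleftrightarrow> L2_loc u \<and> (\<forall>n. L2_loc (f n)) \<and>
     (\<forall>a b. ((\<lambda>n. \<integral>\<^sup>+ x \<in> {a..b}. ennreal (norm (f n x - u x) ^ 2) \<partial>lebesgue) \<longlongrightarrow> 0) sequentially)"

definition Hhat :: "real \<Rightarrow> real set \<Rightarrow> (real \<Rightarrow> 'a::euclidean_space) set" where
  "Hhat s \<omega> = {u. L2_loc u \<and> energy s u \<omega> < \<infinity>}"

definition HhatN :: "real \<Rightarrow> real set \<Rightarrow> 'a::euclidean_space set \<Rightarrow> (real \<Rightarrow> 'a) set" where
  "HhatN s \<omega> N = {u \<in> Hhat s \<omega>. AE x in lebesgue. u x \<in> N}"

definition spt :: "(real \<Rightarrow> 'a::zero) \<Rightarrow> real set" where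
  "spt f = UNIV - \<Union>{U. open U \<and> (AE x in lebesgue. x \<in> U \<longrightarrow> f x = 0)}"

definition minimizing_s_harmonic :: "real \<Rightarrow> real set \<Rightarrow> 'a::euclidean_space set \<Rightarrow> (real \<Rightarrow> 'a) \<Rightarrow> bool" where
  "minimizing_s_harmonic s \<omega> N u \<longleftrightarrow> u \<in> HhatN s \<omega> N \<and>
     (\<forall>v \<in> HhatN s \<omega> N. spt (\<lambda>x. v x - u x) \<subseteq> \<omega> \<longrightarrow> energy s u \<omega> \<le> energy s v \<omega>)"

definition Hs_norm_sq :: "real \<Rightarrow> real set \<Rightarrow> (real \<Rightarrow> 'a::real_normed_vector) \<Rightarrow> ennreal" where
  "Hs_norm_sq s \<omega> v = (\<integral>\<^sup>+ x \<in> \<omega>. ennreal (norm (v x) ^ 2) \<partial>lebesgue)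
      + (\<integral>\<^sup>+ z \<in> \<omega> \<times> \<omega>. frac_integrand s v z \<partial>lebesgue)"

end

theory Submission
  imports Defs
begin

text \<open>Since \<open>s < 1/2\<close>, the kernel \<open>\<bar>x - y\<bar> powr (-1 - 2 * s)\<close> is integrable over \<open>I \<times> - I\<close> for
  every bounded interval \<open>I\<close>, so bounded maps can be cut and pasted at the end points of \<open>I\<close>
  at finite cost, without any interpolation inside \<open>N\<close>. If \<open>v\<close> agrees with the limit \<open>u\<close> outside
  \<open>I\<close>, then the map equal to \<open>v\<close> on \<open>I\<close> and to \<open>f n\<close> elsewhere competes with \<open>f n\<close>, and by
  dominated convergence its energy in \<open>I\<close> tends to that of \<open>v\<close>. Hence the upper limit of the
  energies of \<open>f n\<close> in \<open>I\<close> is at most the energy of \<open>v\<close> in \<open>I\<close>. With \<open>v = u\<close> and Fatou's lemma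
  this gives convergence of the energies; a general \<open>v\<close> gives minimality of \<open>u\<close>. Convergence of
  the energies upgrades almost everywhere convergence to strong convergence by a
  generalized dominated convergence argument.\<close>

section \<open>Lebesgue measure on the plane: coordinate projections and the swap of
  variables\<close>

lemma AE_nonsingular:
  assumes "f \<in> M \<rightarrow>\<^sub>M K" and "\<And>A. A \<in> null_sets K \<Longrightarrow> f -` A \<inter> space M \<in> null_sets M"
    and "AE x in K. P x"
  shows "AE x in M. P (f x)"
proof -
  from assms(3) obtain A where A: "A \<in> null_sets K" "{x\<in>space K. \<not> P x} \<subseteq> A"
    unfolding eventually_ae_filter by auto
  have "{x\<in>space M. \<not> P (f x)} \<subseteq> f -` A \<inter> space M"
    using A(2) measurable_space[OF assms(1)] by auto
  with assms(2)[OF A(1)] show ?thesis unfolding eventually_ae_filter by blast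
qed

text \<open>In \<open>A = S \<union> N\<close> the preimage of \<open>S\<close> is measurable and
  that of \<open>N\<close> lies in a null set. This is needed because \<open>lebesgue\<close> on the
  plane is the completion of the product of Borel measures, not the product of two completed
  measures, so measurability of \<open>fst\<close> and \<open>snd\<close> is not the usual product
  fact.\<close>

lemma measurable_completion_completion:
  assumes f: "f \<in> M \<rightarrow>\<^sub>M K" and n: "\<And>A. A \<in> null_sets K \<Longrightarrow> f -` A \<inter> space M \<in> null_sets M"
  shows "f \<in> completion M \<rightarrow>\<^sub>M completion K"
proof (rule measurableI)
  show "f x \<in> space (completion K)" if "x \<in> space (completion M)" for x
    using that measurable_space[OF f] by simp
  fix A assume "A \<in> sets (completion K)"
  then obtain S N N' where A: "A = S \<union> N" "N \<subseteq> N'" "N' \<in> null_sets K" "S \<in> sets K"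
    unfolding sets_completion by (auto elim: completionE)
  show "f -` A \<inter> space (completion M) \<in> sets (completion M)"
  proof (rule sets_completionI)
    show "f -` A \<inter> space (completion M) = (f -` S \<inter> space M) \<union> (f -` N \<inter> space M)"
      using A by auto
    show "f -` N \<inter> space M \<subseteq> f -` N' \<inter> space M" using A by auto
    show "f -` N' \<inter> space M \<in> null_sets M" using n A by auto
    show "f -` S \<inter> space M \<in> sets M" using f A by (auto intro: measurable_sets)
  qed
qed

lemma null_sets_vimage_fst_lborel:
  assumes "A \<in> null_sets (lborel :: real measure)"
  shows "fst -` A \<inter> space (lborel :: (real \<times> real) measure) \<in> null_sets lborel"
proof -
  have "A \<times> (UNIV :: real set) \<in> null_sets (lborel \<Otimes>\<^sub>M lborel)"
    using assms by (intro lborel.times_in_null_sets1) auto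
  then show ?thesis by (simp add: lborel_prod vimage_fst)
qed

lemma null_sets_vimage_snd_lborel:
  assumes "A \<in> null_sets (lborel :: real measure)"
  shows "snd -` A \<inter> space (lborel :: (real \<times> real) measure) \<in> null_sets lborel"
proof -
  have "(UNIV :: real set) \<times> A \<in> null_sets (lborel \<Otimes>\<^sub>M lborel)"
    using assms by (intro lborel.times_in_null_sets2) auto
  then show ?thesis by (simp add: lborel_prod vimage_snd)
qed

lemma measurable_fst_snd_lborel:
  "(fst :: real \<times> real \<Rightarrow> real) \<in> lborel \<rightarrow>\<^sub>M lborel"
  "(snd :: real \<times> real \<Rightarrow> real) \<in> lborel \<rightarrow>\<^sub>M lborel"
  using measurable_fst[of lborel lborel] measurable_snd[of lborel lborel] by (simp_all add: lborel_prod)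

lemma measurable_fst_lebesgue [measurable]:
  "(fst :: real \<times> real \<Rightarrow> real) \<in> lebesgue \<rightarrow>\<^sub>M lebesgue"
  by (intro measurable_completion_completion measurable_fst_snd_lborel null_sets_vimage_fst_lborel)

lemma measurable_snd_lebesgue [measurable]:
  "(snd :: real \<times> real \<Rightarrow> real) \<in> lebesgue \<rightarrow>\<^sub>M lebesgue"
  by (intro measurable_completion_completion measurable_fst_snd_lborel null_sets_vimage_snd_lborel)

text \<open>Strips over null sets of the line are null in the plane. This carries pointwise
  information about maps of one variable over to the double integrals.\<close>

lemma AE_lebesgue_fst_snd:
  assumes "AE x in lebesgue. P (x :: real)"
  shows "AE z in lebesgue. P (fst (z :: real \<times> real))" "AE z in lebesgue. P (snd (z :: real \<times> real))"
proof -
  have P: "AE x in lborel. P x" using assms by (simp add: AE_completion_iff)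
  show "AE z in lebesgue. P (fst (z :: real \<times> real))"
    by (intro AE_completion AE_nonsingular[OF measurable_fst_snd_lborel(1) null_sets_vimage_fst_lborel P])
  show "AE z in lebesgue. P (snd (z :: real \<times> real))"
    by (intro AE_completion AE_nonsingular[OF measurable_fst_snd_lborel(2) null_sets_vimage_snd_lborel P])
qed

text \<open>Invariance under the swap is available for Borel functions, so the integrand is replaced
  by a Borel representative; the exceptional set stays null after swapping, since the swap preserves
  \<open>lborel\<close>.\<close>

lemma nn_integral_lebesgue_swap:
  fixes g :: "real \<times> real \<Rightarrow> ennreal"
  assumes "g \<in> borel_measurable lebesgue"
  shows "(\<integral>\<^sup>+ z. g (snd z, fst z) \<partial>lebesgue) = (\<integral>\<^sup>+ z. g z \<partial>lebesgue)"
proof -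
  obtain h where h: "h \<in> borel_measurable lborel" and gh: "AE z in lborel. g z = h z"
    using completion_ex_borel_measurable[OF assms] by auto
  have m: "(\<lambda>z. (snd z, fst z)) \<in> (lborel :: (real \<times> real) measure) \<rightarrow>\<^sub>M lborel"
    using measurable_Pair[OF measurable_snd[of lborel lborel] measurable_fst[of lborel lborel]]
    by (simp add: lborel_prod del: measurable_lborel1 measurable_lborel2)
  have d: "distr lborel lborel (\<lambda>z. (snd z, fst z)) = (lborel :: (real \<times> real) measure)"
    using lborel_pair.distr_pair_swap[symmetric] unfolding lborel_prod case_prod_unfold .
  have gh': "AE z in lborel. g (snd z, fst z) = h (snd z, fst z)"
    using AE_distrD[OF m, of "\<lambda>z. g z = h z"] gh unfolding d by simp
  have "(\<integral>\<^sup>+ z. g (snd z, fst z) \<partial>lebesgue) = (\<integral>\<^sup>+ z. h (snd z, fst z) \<partial>lborel)"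
    unfolding nn_integral_completion by (rule nn_integral_cong_AE[OF gh'])
  also have "\<dots> = (\<integral>\<^sup>+ z. h z \<partial>distr lborel lborel (\<lambda>z. (snd z, fst z)))"
    by (rule nn_integral_distr[OF m, symmetric]) (use h in simp)
  also have "\<dots> = (\<integral>\<^sup>+ z. g z \<partial>lebesgue)"
    unfolding d nn_integral_completion by (rule nn_integral_cong_AE) (use gh in auto)
  finally show ?thesis .
qed

section \<open>Integrability of the kernel across the end points of an interval\<close>

lemma nn_integral_kernel_right:
  fixes s a b :: real
  assumes s: "0 < s" "s < 1/2" and ab: "a < b"
  shows "(\<integral>\<^sup>+x. (\<integral>\<^sup>+y. ennreal (\<bar>x - y\<bar> powr (-1 - 2 * s)) * indicator {b..} y \<partial>lborel)
           * indicator {a<..<b} x \<partial>lborel) < \<infinity>" (is "?I < _")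
proof -
  \<comment> \<open>The antiderivative in \<open>y\<close> vanishes at infinity because
    \<open>s > 0\<close>. What remains is a singularity of order \<open>2 * s\<close> at
    \<open>b\<close>, integrable because \<open>2 * s < 1\<close>.\<close>
  have inner: "(\<integral>\<^sup>+y. ennreal (\<bar>x - y\<bar> powr (-1 - 2 * s)) * indicator {b..} y \<partial>lborel)
      = ennreal ((b - x) powr (- 2 * s) / (2 * s))" if "x < b" for x
  proof -
    have e: "- 1 - s * 2 = - (s * 2) - 1" by simp
    have "filterlim (\<lambda>y. y - x) at_top at_top"
      using filterlim_tendsto_add_at_top[OF tendsto_const[of "-x"] filterlim_ident] by simp
    then have "((\<lambda>y. - ((y - x) powr (- 2 * s)) / (2 * s)) \<longlongrightarrow> - 0 / (2 * s)) at_top"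
      using s by (intro tendsto_intros tendsto_neg_powr) auto
    then have "(\<integral>\<^sup>+y. ennreal (\<bar>x - y\<bar> powr (-1 - 2 * s)) * indicator {b..} y \<partial>lborel)
      = ennreal (- 0 / (2 * s) - (- ((b - x) powr (- 2 * s)) / (2 * s)))"
      using that s
      by (intro nn_integral_FTC_atLeast)
         (auto intro!: derivative_eq_intros simp: field_simps e)
    then show ?thesis by simp
  qed
  define p where "p = 1 - 2 * s"
  have p: "0 < p" "- 2 * s = p - 1" using s by (auto simp: p_def)
  \<comment> \<open>An antiderivative of the remaining singular function. It is continuous up to
    \<open>b\<close> because \<open>p > 0\<close>, but is differentiated only in the interior, since
    the integrand blows up at \<open>b\<close>.\<close>
  define F where "F x = - ((b - x) powr p) / (p * (2 * s))" for x
  have hi: "((\<lambda>x. (b - x) powr (- 2 * s) / (2 * s)) has_integral (F b - F a)) {a..b}"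
  proof (rule fundamental_theorem_of_calculus_interior)
    show "continuous_on {a..b} F" unfolding F_def using s p(1)
      by (intro continuous_intros continuous_on_powr') auto
    show "(F has_vector_derivative (b - x) powr (- 2 * s) / (2 * s)) (at x)" if "x \<in> {a<..<b}" for x
      unfolding F_def has_real_derivative_iff_has_vector_derivative[symmetric] p(2) using that s p(1)
      by (auto intro!: derivative_eq_intros)
  qed (use ab in simp)
  have "?I \<le> (\<integral>\<^sup>+x. ennreal ((b - x) powr (- 2 * s) / (2 * s)) * indicator {a..b} x \<partial>lborel)"
    by (rule nn_integral_mono) (auto simp: inner simp del: mult_minus_left split: split_indicator)
  also have "\<dots> = ennreal (F b - F a)"
    by (rule nn_integral_has_integral_lebesgue'[OF _ hi]) (use s in auto)
  finally show ?thesis by (simp add: order_le_less_trans)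
qed

text \<open>Reflecting both variables preserves the kernel and turns the left end point into a right
  one.\<close>

lemma nn_integral_kernel_left:
  fixes s a b :: real
  assumes s: "0 < s" "s < 1/2" and ab: "a < b"
  shows "(\<integral>\<^sup>+x. (\<integral>\<^sup>+y. ennreal (\<bar>x - y\<bar> powr (-1 - 2 * s)) * indicator {..a} y \<partial>lborel)
           * indicator {a<..<b} x \<partial>lborel) < \<infinity>" (is "?I < _")
proof -
  let ?g = "\<lambda>x. \<integral>\<^sup>+y. ennreal (\<bar>x - y\<bar> powr (-1 - 2 * s)) * indicator {..a} y \<partial>lborel"
  have "?I = (\<integral>\<^sup>+x. ?g (-x) * indicator {a<..<b} (-x) \<partial>lborel)"
    by (subst nn_integral_real_affine[where c = "-1" and t = 0]) auto
  also have "\<dots> = (\<integral>\<^sup>+x. (\<integral>\<^sup>+y. ennreal (\<bar>x - y\<bar> powr (-1 - 2 * s)) * indicator {-a..} y \<partial>lborel)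
           * indicator {-b<..<-a} x \<partial>lborel)"
  proof (rule nn_integral_cong)
    fix x :: real
    have "?g (-x) = (\<integral>\<^sup>+y. ennreal (\<bar>-x - -y\<bar> powr (-1 - 2 * s)) * indicator {..a} (-y) \<partial>lborel)"
      by (subst nn_integral_real_affine[where c = "-1" and t = 0]) auto
    also have "\<dots> = (\<integral>\<^sup>+y. ennreal (\<bar>x - y\<bar> powr (-1 - 2 * s)) * indicator {-a..} y \<partial>lborel)"
      by (intro nn_integral_cong) (auto simp: indicator_def abs_minus_commute)
    finally show "?g (-x) * indicator {a<..<b} (-x) = (\<integral>\<^sup>+y. ennreal (\<bar>x - y\<bar> powr (-1 - 2 * s)) * indicator {-a..} y \<partial>lborel)
           * indicator {-b<..<-a} x"
      by (auto simp: indicator_def)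
  qed
  also have "\<dots> < \<infinity>" using nn_integral_kernel_right[OF s, of "-b" "-a"] ab by simp
  finally show ?thesis .
qed

text \<open>By Tonelli the integral splits into the contributions of the two half-lines
  \<open>{b..}\<close> and \<open>{..a}\<close>. The result supplies the integrable majorant for
  every interaction of a bounded map across the boundary of an interval.\<close>

lemma nn_integral_kernel_interval_complement:
  fixes s a b :: real
  assumes s: "0 < s" "s < 1/2" and ab: "a < b"
  shows "(\<integral>\<^sup>+ z \<in> {a<..<b} \<times> (- {a<..<b}). ennreal (1 / \<bar>fst z - snd z\<bar> powr (1 + 2 * s)) \<partial>lebesgue) < \<infinity>"
    (is "?I < _")
proof -
  let ?k = "\<lambda>x y. ennreal (\<bar>x - y\<bar> powr (-1 - 2 * s))"
  have k: "1 / \<bar>t\<bar> powr (1 + 2 * s) = \<bar>t\<bar> powr (-1 - 2 * s)" for t :: real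
    using powr_minus_divide[of "\<bar>t\<bar>" "1 + 2 * s"] by simp
  have "?I = (\<integral>\<^sup>+ z. ?k (fst z) (snd z) * indicator ({a<..<b} \<times> (- {a<..<b})) z \<partial>(lborel \<Otimes>\<^sub>M lborel))"
    unfolding nn_integral_completion k lborel_prod ..
  also have "\<dots> = (\<integral>\<^sup>+ x. \<integral>\<^sup>+ y. ?k x y * indicator ({a<..<b} \<times> (- {a<..<b})) (x, y) \<partial>lborel \<partial>lborel)"
    by (subst lborel.nn_integral_fst[symmetric]) auto
  also have "\<dots> = (\<integral>\<^sup>+ x. (\<integral>\<^sup>+ y. ?k x y * indicator {b..} y \<partial>lborel) * indicator {a<..<b} x
      + (\<integral>\<^sup>+ y. ?k x y * indicator {..a} y \<partial>lborel) * indicator {a<..<b} x \<partial>lborel)"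
  proof (rule nn_integral_cong)
    fix x
    have "(\<integral>\<^sup>+ y. ?k x y * indicator ({a<..<b} \<times> (- {a<..<b})) (x, y) \<partial>lborel)
      = (\<integral>\<^sup>+ y. (?k x y * indicator {b..} y + ?k x y * indicator {..a} y) * indicator {a<..<b} x \<partial>lborel)"
      using ab by (intro nn_integral_cong) (auto simp: indicator_def)
    also have "\<dots> = (\<integral>\<^sup>+ y. ?k x y * indicator {b..} y + ?k x y * indicator {..a} y \<partial>lborel) * indicator {a<..<b} x"
      by (rule nn_integral_multc) auto
    also have "\<dots> = (\<integral>\<^sup>+ y. ?k x y * indicator {b..} y \<partial>lborel) * indicator {a<..<b} x
      + (\<integral>\<^sup>+ y. ?k x y * indicator {..a} y \<partial>lborel) * indicator {a<..<b} x"
      by (subst nn_integral_add) (auto simp: distrib_right)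
    finally show "(\<integral>\<^sup>+ y. ?k x y * indicator ({a<..<b} \<times> (- {a<..<b})) (x, y) \<partial>lborel) = \<dots>" .
  qed
  also have "\<dots> < \<infinity>"
    using nn_integral_kernel_right[OF assms] nn_integral_kernel_left[OF assms]
    by (subst nn_integral_add) auto
  finally show ?thesis .
qed

section \<open>The energy as a sum of interactions between sets\<close>

lemma borel_measurable_frac_integrand:
  fixes w :: "real \<Rightarrow> 'a::euclidean_space"
  assumes w: "w \<in> borel_measurable lebesgue"
  shows "frac_integrand s w \<in> borel_measurable lebesgue"
proof -
  have [measurable]: "(\<lambda>z. w (fst z)) \<in> borel_measurable (lebesgue :: (real \<times> real) measure)"
    "(\<lambda>z. w (snd z)) \<in> borel_measurable (lebesgue :: (real \<times> real) measure)"
    using measurable_compose[OF measurable_fst_lebesgue w] measurable_compose[OF measurable_snd_lebesgue w] .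
  have [measurable]: "(\<lambda>z. \<bar>fst z - snd z\<bar>) \<in> borel_measurable (lebesgue :: (real \<times> real) measure)"
    by (rule measurable_completion) (auto intro!: borel_measurable_continuous_onI continuous_intros)
  show ?thesis unfolding frac_integrand_def case_prod_unfold by measurable
qed

text \<open>Both terms of \<open>energy\<close> have this form. Symmetry and additivity in each set
  reduce localization of the energy to bookkeeping.\<close>

definition interaction :: "real \<Rightarrow> (real \<Rightarrow> 'a::real_normed_vector) \<Rightarrow> real set \<Rightarrow> real set \<Rightarrow> ennreal" where
  "interaction s w A B = (\<integral>\<^sup>+ z \<in> A \<times> B. frac_integrand s w z \<partial>lebesgue)"

lemma energy_interaction:
  "energy s w I = ennreal (gamma_s s / 2) * interaction s w I I + ennreal (gamma_s s) * interaction s w I (- I)"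
  by (simp add: energy_def interaction_def Compl_eq_Diff_UNIV)

lemma frac_integrand_swap: "frac_integrand s w (snd z, fst z) = frac_integrand s w z"
  by (simp add: frac_integrand_def case_prod_unfold norm_minus_commute abs_minus_commute)

lemma sets_lebesgue_Times:
  "A \<in> sets borel \<Longrightarrow> B \<in> sets borel \<Longrightarrow> A \<times> B \<in> sets (lebesgue :: (real \<times> real) measure)"
  by (auto intro!: sets_completionI_sets borel_Times)

context
  fixes s :: real and w :: "real \<Rightarrow> 'a::euclidean_space"
  assumes w: "w \<in> borel_measurable lebesgue"
begin

lemma borel_measurable_frac_integrand_indicator:
  assumes "A \<in> sets borel" "B \<in> sets borel"
  shows "(\<lambda>z. frac_integrand s w z * indicator (A \<times> B) z) \<in> borel_measurable lebesgue"
  using borel_measurable_frac_integrand[OF w] sets_lebesgue_Times[OF assms]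
  by (intro borel_measurable_times_ennreal borel_measurable_indicator)

lemma interaction_commute:
  assumes "A \<in> sets borel" "B \<in> sets borel"
  shows "interaction s w A B = interaction s w B A"
proof -
  have "interaction s w B A = (\<integral>\<^sup>+ z. frac_integrand s w (snd z, fst z) * indicator (A \<times> B) (snd z, fst z) \<partial>lebesgue)"
    unfolding interaction_def frac_integrand_swap by (intro nn_integral_cong) (auto simp: indicator_def)
  also have "\<dots> = interaction s w A B"
    unfolding interaction_def
    by (rule nn_integral_lebesgue_swap) (rule borel_measurable_frac_integrand_indicator[OF assms])
  finally show ?thesis ..
qed

lemma interaction_Un_right:
  assumes "A \<in> sets borel" "B \<in> sets borel" "C \<in> sets borel" "B \<inter> C = {}"
  shows "interaction s w A (B \<union> C) = interaction s w A B + interaction s w A C"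
proof -
  have "interaction s w A (B \<union> C) = (\<integral>\<^sup>+ z. frac_integrand s w z * indicator (A \<times> B) z
     + frac_integrand s w z * indicator (A \<times> C) z \<partial>lebesgue)"
    unfolding interaction_def using assms(4) by (intro nn_integral_cong) (auto simp: indicator_def)
  also have "\<dots> = interaction s w A B + interaction s w A C"
    unfolding interaction_def by (intro nn_integral_add borel_measurable_frac_integrand_indicator assms)
  finally show ?thesis .
qed

lemma interaction_Un_left:
  assumes "A \<in> sets borel" "B \<in> sets borel" "C \<in> sets borel" "B \<inter> C = {}"
  shows "interaction s w (B \<union> C) A = interaction s w B A + interaction s w C A"
  using interaction_Un_right[OF assms] assms(1-3) by (simp add: interaction_commute[of _ A])

text \<open>The pairs joining \<open>I\<close> and \<open>S - I\<close> occur twice in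
  \<open>S \<times> S\<close> with weight \<open>gamma_s s / 2\<close>, and once in
  \<open>I \<times> - I\<close> with weight \<open>gamma_s s\<close>, so they are absorbed
  completely by the energy in \<open>I\<close>. The remainder sees only values outside
  \<open>I\<close>, hence is unchanged when a map is modified inside \<open>I\<close>.\<close>

lemma energy_split:
  assumes I: "I \<in> sets borel" and S: "S \<in> sets borel" and IS: "I \<subseteq> S"
  shows "energy s w S = energy s w I + (ennreal (gamma_s s / 2) * interaction s w (S - I) (S - I)
      + ennreal (gamma_s s) * interaction s w (S - I) (- S))"
proof -
  let ?D = "S - I" and ?J = "interaction s w" and ?h = "ennreal (gamma_s s / 2)"
  have SI: "S = I \<union> ?D" "- I = ?D \<union> - S" using IS by auto
  have 1: "?J S S = ?J I I + ?J I ?D + (?J I ?D + ?J ?D ?D)"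
    using interaction_Un_left[of S I ?D] interaction_Un_right[of I I ?D] interaction_Un_right[of ?D I ?D]
      interaction_commute[of ?D I] I S SI(1)[symmetric] by (simp add: sets.Diff del: Un_Diff_cancel)
  have 2: "?J S (- S) = ?J I (- S) + ?J ?D (- S)"
    using interaction_Un_left[of "- S" I ?D] I S SI(1)[symmetric] by (simp add: sets.Diff del: Un_Diff_cancel)
  have 3: "?J I (- I) = ?J I ?D + ?J I (- S)"
    using I S by (subst SI(2)) (subst interaction_Un_right, auto)
  \<comment> \<open>No sign of \<open>gamma_s s\<close> is assumed here; for a negative value both
    sides are truncated to 0.\<close>
  have g: "ennreal (gamma_s s) = ?h + ?h"
  proof (cases "0 \<le> gamma_s s")
    case True
    then show ?thesis by (subst ennreal_plus[symmetric]) auto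
  qed (simp add: ennreal_neg)
  show ?thesis unfolding energy_interaction 1 2 3 g by (simp add: algebra_simps)
qed

text \<open>A single integral allows Fatou's lemma to be applied to both terms at once.\<close>

lemma energy_eq_nn_integral:
  assumes "I \<in> sets borel"
  shows "energy s w I = (\<integral>\<^sup>+ z. ennreal (gamma_s s / 2) * (frac_integrand s w z * indicator (I \<times> I) z)
     + ennreal (gamma_s s) * (frac_integrand s w z * indicator (I \<times> - I) z) \<partial>lebesgue)"
  unfolding energy_interaction interaction_def using assms
  using borel_measurable_frac_integrand_indicator[of I I] borel_measurable_frac_integrand_indicator[of I "- I"]
  by (simp add: nn_integral_add nn_integral_cmult borel_measurable_times_ennreal
      del: nn_integral_completion)

end

section \<open>Bounds, limits and lower semicontinuity\<close>

lemma frac_integrand_cong_AE: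
  fixes w :: "real \<Rightarrow> 'a::real_normed_vector"
  assumes "AE x in lebesgue. x \<in> A \<union> B \<longrightarrow> w x = w' x"
  shows "AE z in lebesgue. frac_integrand s w z * indicator (A \<times> B) z = frac_integrand s w' z * indicator (A \<times> B) z"
  using AE_lebesgue_fst_snd[OF assms]
  by eventually_elim (auto simp: frac_integrand_def indicator_def)

lemma interaction_cong_AE:
  assumes "AE x in lebesgue. x \<in> A \<union> B \<longrightarrow> w x = w' x"
  shows "interaction s w A B = interaction s w' A B"
  unfolding interaction_def by (rule nn_integral_cong_AE[OF frac_integrand_cong_AE[OF assms]])

lemma frac_integrand_le_of_bounded:
  fixes w :: "real \<Rightarrow> 'a::real_normed_vector"
  assumes "AE x in lebesgue. norm (w x) \<le> C"
  shows "AE z in lebesgue. frac_integrand s w z \<le> ennreal (4 * C\<^sup>2) * ennreal (1 / \<bar>fst z - snd z\<bar> powr (1 + 2 * s))"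
  using AE_lebesgue_fst_snd[OF assms]
proof eventually_elim
  fix z :: "real \<times> real" assume z: "norm (w (fst z)) \<le> C" "norm (w (snd z)) \<le> C"
  \<comment> \<open>The factor 4 in the bound is the square of this 2.\<close>
  have "norm (w (fst z) - w (snd z)) \<le> 2 * C"
    using norm_triangle_ineq4[of "w (fst z)" "w (snd z)"] z by simp
  then have "norm (w (fst z) - w (snd z)) ^ 2 \<le> (2 * C) ^ 2" by (intro power_mono) auto
  then show "frac_integrand s w z \<le> ennreal (4 * C\<^sup>2) * ennreal (1 / \<bar>fst z - snd z\<bar> powr (1 + 2 * s))"
    by (auto simp: frac_integrand_def case_prod_unfold ennreal_mult[symmetric] power_mult_distrib
       intro!: ennreal_leI divide_right_mono)
qed

lemma borel_measurable_kernel_indicator: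
  "(\<lambda>z :: real \<times> real. ennreal (1 / \<bar>fst z - snd z\<bar> powr (1 + 2 * s)) * indicator ({a<..<b} \<times> - {a<..<b}) z)
    \<in> borel_measurable lborel"
proof (intro borel_measurable_times_ennreal borel_measurable_indicator)
  have [measurable]: "(\<lambda>z :: real \<times> real. \<bar>fst z - snd z\<bar>) \<in> borel_measurable lborel"
    by (auto intro!: borel_measurable_continuous_onI continuous_intros)
  show "(\<lambda>z :: real \<times> real. ennreal (1 / \<bar>fst z - snd z\<bar> powr (1 + 2 * s))) \<in> borel_measurable lborel"
    by measurable
qed (auto intro!: borel_Times)

lemma kernel_const_mult_finite:
  assumes "0 < s" "s < 1/2" "a < b"
  shows "(\<integral>\<^sup>+ z. (ennreal (4 * C\<^sup>2) * ennreal (1 / \<bar>fst z - snd z\<bar> powr (1 + 2 * s)))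
     * indicator ({a<..<b} \<times> - {a<..<b}) z \<partial>lebesgue) < \<infinity>"
  using nn_integral_kernel_interval_complement[OF assms] measurable_completion[OF borel_measurable_kernel_indicator]
  unfolding mult.assoc
  by (subst nn_integral_cmult) (auto simp: ennreal_mult_less_top simp del: nn_integral_completion)

lemma interaction_complement_finite:
  assumes "0 < s" "s < 1/2" "a < b" and "AE x in lebesgue. norm (w x) \<le> C"
  shows "interaction s w {a<..<b} (- {a<..<b}) < \<infinity>"
proof -
  have "interaction s w {a<..<b} (- {a<..<b}) \<le> (\<integral>\<^sup>+ z. (ennreal (4 * C\<^sup>2) * ennreal (1 / \<bar>fst z - snd z\<bar> powr (1 + 2 * s)))
     * indicator ({a<..<b} \<times> - {a<..<b}) z \<partial>lebesgue)"
    unfolding interaction_def using frac_integrand_le_of_bounded[OF assms(4), of s]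
    by (intro nn_integral_mono_AE) (auto elim!: eventually_mono intro!: mult_right_mono)
  then show ?thesis using kernel_const_mult_finite[OF assms(1-3), of C] by (rule order_le_less_trans)
qed

lemma frac_integrand_tendsto:
  fixes w :: "real \<Rightarrow> 'a::real_normed_vector"
  assumes "AE x in lebesgue. (\<lambda>n. f n x) \<longlonglongrightarrow> w x"
  shows "AE z in lebesgue. (\<lambda>n. frac_integrand s (f n) z) \<longlonglongrightarrow> frac_integrand s w z"
  using AE_lebesgue_fst_snd[OF assms]
proof eventually_elim
  fix z :: "real \<times> real" assume z: "(\<lambda>n. f n (fst z)) \<longlonglongrightarrow> w (fst z)" "(\<lambda>n. f n (snd z)) \<longlonglongrightarrow> w (snd z)"
  show "(\<lambda>n. frac_integrand s (f n) z) \<longlonglongrightarrow> frac_integrand s w z"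
    unfolding frac_integrand_def case_prod_unfold
  \<comment> \<open>On the diagonal the numerator is 0 for every map, so continuity of the quotient
    matters only off it.\<close>
  proof (cases "fst z = snd z")
    case False
    then show "(\<lambda>n. ennreal ((norm (f n (fst z) - f n (snd z)))\<^sup>2 / \<bar>fst z - snd z\<bar> powr (1 + 2 * s)))
       \<longlonglongrightarrow> ennreal ((norm (w (fst z) - w (snd z)))\<^sup>2 / \<bar>fst z - snd z\<bar> powr (1 + 2 * s))"
      by (intro tendsto_ennrealI tendsto_intros z) auto
  qed simp
qed

text \<open>Dominated convergence with the kernel times \<open>4 * C\<^sup>2\<close> as majorant.
  The argument is confined to pairs across the boundary of the interval: over the square of the
  interval the kernel is not integrable.\<close>

lemma interaction_complement_tendsto:
  fixes w :: "real \<Rightarrow> 'a::euclidean_space"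
  assumes "0 < s" "s < 1/2" "a < b"
    and f: "\<And>n. f n \<in> borel_measurable lebesgue" and w: "w \<in> borel_measurable lebesgue"
    and C: "\<And>n. AE x in lebesgue. norm (f n x) \<le> C"
    and lim: "AE x in lebesgue. (\<lambda>n. f n x) \<longlonglongrightarrow> w x"
  shows "(\<lambda>n. interaction s (f n) {a<..<b} (- {a<..<b})) \<longlonglongrightarrow> interaction s w {a<..<b} (- {a<..<b})"
  unfolding interaction_def
proof (rule nn_integral_dominated_convergence[where
    w = "\<lambda>z. (ennreal (4 * C\<^sup>2) * ennreal (1 / \<bar>fst z - snd z\<bar> powr (1 + 2 * s)))
     * indicator ({a<..<b} \<times> - {a<..<b}) z"])
  show "AE z in lebesgue. frac_integrand s (f j) z * indicator ({a<..<b} \<times> - {a<..<b}) z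
      \<le> (ennreal (4 * C\<^sup>2) * ennreal (1 / \<bar>fst z - snd z\<bar> powr (1 + 2 * s)))
        * indicator ({a<..<b} \<times> - {a<..<b}) z" for j
    using frac_integrand_le_of_bounded[OF C[of j], of s]
    by eventually_elim (auto intro!: mult_right_mono)
  show "AE z in lebesgue. (\<lambda>j. frac_integrand s (f j) z * indicator ({a<..<b} \<times> - {a<..<b}) z)
     \<longlonglongrightarrow> frac_integrand s w z * indicator ({a<..<b} \<times> - {a<..<b}) z"
    using frac_integrand_tendsto[OF lim, of s] by eventually_elim (auto simp: indicator_def)
  show "(\<lambda>z. (ennreal (4 * C\<^sup>2) * ennreal (1 / \<bar>fst z - snd z\<bar> powr (1 + 2 * s)))
     * indicator ({a<..<b} \<times> - {a<..<b}) z) \<in> borel_measurable lebesgue"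
    unfolding mult.assoc
    by (intro borel_measurable_times_ennreal measurable_completion[OF borel_measurable_kernel_indicator]) auto
qed (rule kernel_const_mult_finite[OF assms(1-3)] borel_measurable_frac_integrand_indicator f w | simp)+

lemma energy_le_liminf:
  fixes w :: "real \<Rightarrow> 'a::euclidean_space"
  assumes I: "I \<in> sets borel"
    and f: "\<And>n. f n \<in> borel_measurable lebesgue" and w: "w \<in> borel_measurable lebesgue"
    and lim: "AE x in lebesgue. (\<lambda>n. f n x) \<longlonglongrightarrow> w x"
  shows "energy s w I \<le> liminf (\<lambda>n. energy s (f n) I)"
proof -
  let ?E = "\<lambda>w z. ennreal (gamma_s s / 2) * (frac_integrand s w z * indicator (I \<times> I) z)
     + ennreal (gamma_s s) * (frac_integrand s w z * indicator (I \<times> - I) z)"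
  have "AE z in lebesgue. ?E w z = liminf (\<lambda>n. ?E (f n) z)"
    using frac_integrand_tendsto[OF lim, of s]
  proof eventually_elim
    fix z assume z: "(\<lambda>n. frac_integrand s (f n) z) \<longlonglongrightarrow> frac_integrand s w z"
    have "(\<lambda>n. ?E (f n) z) \<longlonglongrightarrow> ?E w z"
      using z by (intro tendsto_add ennreal_tendsto_cmult) (auto simp: indicator_def)
    then show "?E w z = liminf (\<lambda>n. ?E (f n) z)" by (simp add: lim_imp_Liminf)
  qed
  then have "energy s w I = (\<integral>\<^sup>+ z. liminf (\<lambda>n. ?E (f n) z) \<partial>lebesgue)"
    unfolding energy_eq_nn_integral[OF w I] by (rule nn_integral_cong_AE)
  also have "\<dots> \<le> liminf (\<lambda>n. energy s (f n) I)"
    unfolding energy_eq_nn_integral[OF f I] using f I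
    by (intro nn_integral_liminf borel_measurable_add borel_measurable_times_ennreal
        borel_measurable_const borel_measurable_frac_integrand_indicator) auto
  finally show ?thesis .
qed

text \<open>Dominated convergence with a moving majorant. Fatou for \<open>W n - D n\<close> bounds
  the lower limit of its integrals below by the integral of \<open>V\<close>, while
  \<open>W n - D n \<le> W n\<close> bounds the upper limit above by the same number; subtracting
  leaves nothing for \<open>D n\<close>.\<close>

lemma nn_integral_tendsto_0_of_dominated:
  fixes D W :: "nat \<Rightarrow> 'b \<Rightarrow> ennreal"
  assumes [measurable]: "\<And>n. D n \<in> borel_measurable M" "\<And>n. W n \<in> borel_measurable M" "V \<in> borel_measurable M"
    and le: "\<And>n x. D n x \<le> W n x"
    and D: "AE x in M. (\<lambda>n. D n x) \<longlonglongrightarrow> 0" and W: "AE x in M. (\<lambda>n. W n x) \<longlonglongrightarrow> V x"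
    and int: "(\<lambda>n. integral\<^sup>N M (W n)) \<longlonglongrightarrow> integral\<^sup>N M V" and fin: "integral\<^sup>N M V < \<infinity>"
  shows "(\<lambda>n. integral\<^sup>N M (D n)) \<longlonglongrightarrow> 0"
proof -
  let ?H = "\<lambda>n x. W n x - D n x"
  have "AE x in M. V x = liminf (\<lambda>n. ?H n x)"
    using D W
  proof eventually_elim
    fix x assume "(\<lambda>n. D n x) \<longlonglongrightarrow> 0" "(\<lambda>n. W n x) \<longlonglongrightarrow> V x"
    then have "(\<lambda>n. ?H n x) \<longlonglongrightarrow> V x - 0" by (intro tendsto_diff_ennreal_general) auto
    then show "V x = liminf (\<lambda>n. ?H n x)" by (simp add: lim_imp_Liminf)
  qed
  then have "integral\<^sup>N M V = (\<integral>\<^sup>+ x. liminf (\<lambda>n. ?H n x) \<partial>M)" by (rule nn_integral_cong_AE)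
  also have "\<dots> \<le> liminf (\<lambda>n. integral\<^sup>N M (?H n))" by (rule nn_integral_liminf) measurable
  finally have lower: "integral\<^sup>N M V \<le> liminf (\<lambda>n. integral\<^sup>N M (?H n))" .
  have "limsup (\<lambda>n. integral\<^sup>N M (?H n)) \<le> limsup (\<lambda>n. integral\<^sup>N M (W n))"
    by (intro Limsup_mono always_eventually allI nn_integral_mono) (simp add: diff_le_self_ennreal)
  also have "\<dots> = integral\<^sup>N M V" by (rule lim_imp_Limsup[OF _ int]) simp
  finally have upper: "limsup (\<lambda>n. integral\<^sup>N M (?H n)) \<le> integral\<^sup>N M V" .
  have H: "(\<lambda>n. integral\<^sup>N M (?H n)) \<longlonglongrightarrow> integral\<^sup>N M V"
    using lower upper Liminf_le_Limsup[of sequentially "\<lambda>n. integral\<^sup>N M (?H n)"]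
    by (intro Liminf_eq_Limsup) (auto intro: antisym order_trans)
  have sum: "integral\<^sup>N M (W n) = integral\<^sup>N M (D n) + integral\<^sup>N M (?H n)" for n
    using le by (subst nn_integral_add[symmetric]) (auto simp: add_diff_inverse_ennreal intro!: nn_integral_cong)
  \<comment> \<open>Cancellation in the extended reals requires finite terms, which the finite limit
    provides from some index on.\<close>
  have "eventually (\<lambda>n. integral\<^sup>N M (?H n) < \<infinity>) sequentially"
    using order_tendstoD(2)[OF H] fin by simp
  then have "eventually (\<lambda>n. integral\<^sup>N M (W n) - integral\<^sup>N M (?H n) = integral\<^sup>N M (D n)) sequentially"
    by eventually_elim (simp add: sum)
  moreover have "(\<lambda>n. integral\<^sup>N M (W n) - integral\<^sup>N M (?H n)) \<longlonglongrightarrow> integral\<^sup>N M V - integral\<^sup>N M V"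
    using fin by (intro tendsto_diff_ennreal_general int H) auto
  ultimately show ?thesis using fin by (auto dest: Lim_transform_eventually)
qed

section \<open>Competitors obtained by cutting and pasting\<close>

lemma gamma_s_pos:
  assumes "0 < s" "s < 1/2"
  shows "0 < gamma_s s"
  unfolding gamma_s_def using assms
  by (intro divide_pos_pos mult_pos_pos Gamma_real_pos) auto

lemma L2_locI_bounded:
  assumes w: "w \<in> borel_measurable lebesgue" and C: "AE x in lebesgue. norm (w x) \<le> C"
  shows "L2_loc w"
  unfolding L2_loc_def
proof (intro conjI allI w)
  fix a b
  have "(\<integral>\<^sup>+ x \<in> {a..b}. ennreal (norm (w x) ^ 2) \<partial>lebesgue) \<le> (\<integral>\<^sup>+ x. ennreal (C ^ 2) * indicator {a..b} x \<partial>lebesgue)"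
  proof (rule nn_integral_mono_AE)
    show "AE x in lebesgue. ennreal (norm (w x) ^ 2) * indicator {a..b} x \<le> ennreal (C ^ 2) * indicator {a..b} x"
      using C by eventually_elim (auto intro!: mult_right_mono ennreal_leI power_mono)
  qed
  also have "\<dots> < \<infinity>"
    by (subst nn_integral_cmult_indicator) (auto simp: ennreal_mult_less_top emeasure_lborel_Icc_eq)
  finally show "(\<integral>\<^sup>+ x \<in> {a..b}. ennreal (norm (w x) ^ 2) \<partial>lebesgue) < \<infinity>" .
qed

lemma AE_bounded:
  fixes N :: "'a::real_normed_vector set"
  assumes "\<forall>x\<in>N. norm x \<le> C" "AE x in lebesgue. w x \<in> N"
  shows "AE x in lebesgue. norm (w x) \<le> C"
  using assms by (auto elim!: eventually_mono)

lemma HhatND: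
  assumes "w \<in> HhatN s \<Omega> N"
  shows "w \<in> borel_measurable lebesgue" "energy s w \<Omega> < \<infinity>" "AE x in lebesgue. w x \<in> N"
  using assms by (auto simp: HhatN_def Hhat_def L2_loc_def)

text \<open>Boundedness of \<open>N\<close> makes local square integrability automatic, so
  admissibility of a competitor comes down to measurability, the constraint and finite
  energy.\<close>

lemma HhatNI:
  fixes N :: "'a::euclidean_space set"
  assumes "\<forall>x\<in>N. norm x \<le> C"
    and "w \<in> borel_measurable lebesgue" "energy s w \<Omega> < \<infinity>" "AE x in lebesgue. w x \<in> N"
  shows "w \<in> HhatN s \<Omega> N"
  using assms L2_locI_bounded[OF assms(2) AE_bounded[OF assms(1,4)]] by (simp add: HhatN_def Hhat_def)

definition glue :: "real set \<Rightarrow> (real \<Rightarrow> 'a) \<Rightarrow> (real \<Rightarrow> 'a) \<Rightarrow> real \<Rightarrow> 'a" where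
  "glue I v g x = (if x \<in> I then v x else g x)"

lemma borel_measurable_glue:
  assumes "I \<in> sets borel" "v \<in> borel_measurable lebesgue" "g \<in> borel_measurable lebesgue"
  shows "glue I v g \<in> borel_measurable lebesgue"
  unfolding glue_def[abs_def] using assms by (intro measurable_If_set) auto

text \<open>The glued map may jump at \<open>a'\<close> and \<open>b'\<close>: its interaction
  across them is finite by the kernel bound, and inside it inherits the energy of \<open>v\<close>.
  It is therefore admissible, and the part of the energy not involving the inner interval, common to
  both maps, cancels from the minimality inequality.\<close>

lemma minimizing_s_harmonic_le_glue:
  fixes N :: "'a::euclidean_space set"
  assumes s: "0 < s" "s < 1/2" and N: "\<forall>x\<in>N. norm x \<le> C"
    and I: "a < a'" "a' < b'" "b' < b"
    and g: "minimizing_s_harmonic s {a<..<b} N g" and v: "v \<in> HhatN s {a<..<b} N"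
  shows "energy s g {a'<..<b'} \<le> energy s (glue {a'<..<b'} v g) {a'<..<b'}"
proof -
  let ?S = "{a<..<b}" and ?I = "{a'<..<b'}"
  let ?w = "glue ?I v g"
  \<comment> \<open>The remainder of \<open>energy_split\<close>, which depends only on values
    outside the inner interval.\<close>
  define R where "R w = ennreal (gamma_s s / 2) * interaction s w (?S - ?I) (?S - ?I)
      + ennreal (gamma_s s) * interaction s w (?S - ?I) (- ?S)" for w :: "real \<Rightarrow> 'a"
  have gN: "g \<in> HhatN s ?S N" using g by (simp add: minimizing_s_harmonic_def)
  note g' = HhatND[OF gN] and v' = HhatND[OF v]
  have split: "energy s w ?S = energy s w ?I + R w" if "w \<in> borel_measurable lebesgue" for w :: "real \<Rightarrow> 'a"
    unfolding R_def by (rule energy_split[OF that]) (use I in auto)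
  have wm: "?w \<in> borel_measurable lebesgue" using g' v' by (intro borel_measurable_glue) auto
  have wN: "AE x in lebesgue. ?w x \<in> N"
    using g'(3) v'(3) by eventually_elim (auto simp: glue_def)
  have Rw: "R ?w = R g"
    unfolding R_def
    by (intro arg_cong2[where f="(+)"] arg_cong2[where f="(*)"] refl interaction_cong_AE AE_I2)
       (use I in \<open>auto simp: glue_def\<close>)
  \<comment> \<open>Finiteness serves twice: for the energy of the glued map and for the final
    cancellation.\<close>
  have Rg: "R g < \<infinity>" using g'(2) unfolding split[OF g'(1)] by simp
  have "interaction s ?w ?I ?I = interaction s v ?I ?I"
    by (intro interaction_cong_AE AE_I2) (auto simp: glue_def)
  moreover have "energy s v ?I < \<infinity>" using v'(2) unfolding split[OF v'(1)] by simp
  moreover have "interaction s ?w ?I (- ?I) < \<infinity>"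
    by (rule interaction_complement_finite[OF s I(2) AE_bounded[OF N wN]])
  ultimately have "energy s ?w ?I < \<infinity>"
    unfolding energy_interaction by (simp add: ennreal_mult_less_top)
  with Rg Rw have "energy s ?w ?S < \<infinity>" unfolding split[OF wm] by simp
  then have "?w \<in> HhatN s ?S N" by (intro HhatNI[OF N] wm wN)
  moreover have "spt (\<lambda>x. ?w x - g x) \<subseteq> ?S"
  proof -
    \<comment> \<open>The support may reach the end points, hence the closed interval; the strict
      inequalities keep it inside \<open>?S\<close>.\<close>
    have "- {a'..b'} \<subseteq> \<Union>{U. open U \<and> (AE x in lebesgue. x \<in> U \<longrightarrow> ?w x - g x = 0)}"
      by (rule Union_upper) (auto simp: glue_def intro!: AE_I2)
    then have "spt (\<lambda>x. ?w x - g x) \<subseteq> {a'..b'}" unfolding spt_def by blast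
    also have "\<dots> \<subseteq> ?S" using I by auto
    finally show ?thesis .
  qed
  ultimately have "energy s g ?S \<le> energy s ?w ?S"
    using g unfolding minimizing_s_harmonic_def by blast
  then show ?thesis
    unfolding split[OF wm] split[OF g'(1)] Rw using Rg by (auto simp: ennreal_add_left_cancel_le add.commute[of _ "R g"])
qed

text \<open>The support is compact in an open interval, so there is room between its extreme points
  and the end points. The result puts every admissible perturbation into the form required for
  gluing.\<close>

lemma spt_subset_interval:
  fixes w :: "real \<Rightarrow> 'a::zero"
  assumes "spt w \<subseteq> {a<..<b}" "a < b"
  shows "\<exists>a' b'. a < a' \<and> a' < b' \<and> b' < b \<and> (AE x in lebesgue. x \<notin> {a'<..<b'} \<longrightarrow> w x = 0)"
proof -
  define \<U> where "\<U> = {U. open U \<and> (AE x in lebesgue. x \<in> U \<longrightarrow> w x = 0)}"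
  have spt: "spt w = - \<Union>\<U>" by (auto simp: spt_def \<U>_def)
  \<comment> \<open>The open sets defining the support may be uncountably many; a countable
    subfamily with the same union allows their null sets to be collected into one.\<close>
  obtain \<V> where \<V>: "\<V> \<subseteq> \<U>" "countable \<V>" "\<Union>\<V> = \<Union>\<U>"
    using Lindelof[of \<U>] by (auto simp: \<U>_def)
  have "AE x in lebesgue. \<forall>U\<in>\<V>. x \<in> U \<longrightarrow> w x = 0"
    using \<V> by (subst AE_ball_countable) (auto simp: \<U>_def)
  then have ae: "AE x in lebesgue. x \<notin> spt w \<longrightarrow> w x = 0"
    using \<V>(3) unfolding spt by (auto elim!: eventually_mono)
  have "\<exists>a' b'. a < a' \<and> a' < b' \<and> b' < b \<and> spt w \<subseteq> {a'<..<b'}"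
  proof (cases "spt w = {}")
    case True
    then show ?thesis using assms(2) dense[of a b] dense[of _ b] by (metis empty_subsetI)
  next
    case False
    have "closed (spt w)" unfolding spt by (intro closed_Compl open_Union) (auto simp: \<U>_def)
    moreover have "bounded (spt w)" using assms(1) by (metis box_real(1) bounded_box bounded_subset)
    ultimately have c: "compact (spt w)" by (simp add: compact_eq_bounded_closed)
    obtain l where l: "l \<in> spt w" "\<And>x. x \<in> spt w \<Longrightarrow> l \<le> x" using compact_attains_inf[OF c False] by blast
    obtain m where m: "m \<in> spt w" "\<And>x. x \<in> spt w \<Longrightarrow> x \<le> m" using compact_attains_sup[OF c False] by blast
    have "a < l" "m < b" using l m assms by auto
    then obtain a' b' where "a < a'" "a' < l" "m < b'" "b' < b" using dense by metis
    moreover have "l \<le> m" using l m by auto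
    moreover have "spt w \<subseteq> {a'<..<b'}" using l m calculation by fastforce
    ultimately show ?thesis by (intro exI[of _ a'] exI[of _ b']) auto
  qed
  then show ?thesis using ae by (metis (no_types, lifting) eventually_mono subsetD)
qed

section \<open>Passage to the limit under almost everywhere convergence\<close>

context
  fixes s :: real and N :: "'a::euclidean_space set" and a b C :: real
    and f :: "nat \<Rightarrow> real \<Rightarrow> 'a" and u :: "real \<Rightarrow> 'a"
  assumes s: "0 < s" "s < 1/2" and ab: "a < b"
    and N: "closed N" "\<forall>x\<in>N. norm x \<le> C"
    and min: "\<And>n. minimizing_s_harmonic s {a<..<b} N (f n)"
    and bdd: "(SUP n. energy s (f n) {a<..<b}) < \<infinity>"
    and u: "u \<in> borel_measurable lebesgue"
    and lim: "AE x in lebesgue. (\<lambda>n. f n x) \<longlonglongrightarrow> u x"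
begin

lemma f_HhatN: "f n \<in> HhatN s {a<..<b} N"
  using min by (simp add: minimizing_s_harmonic_def)

lemmas f_facts = HhatND[OF f_HhatN]

text \<open>Fatou's lemma bounds the energy of the limit, and closedness of \<open>N\<close>
  preserves the constraint.\<close>

lemma limit_HhatN: "u \<in> HhatN s {a<..<b} N"
proof (rule HhatNI[OF N(2) u])
  have "energy s u {a<..<b} \<le> liminf (\<lambda>n. energy s (f n) {a<..<b})"
    by (intro energy_le_liminf f_facts u lim) auto
  also have "\<dots> \<le> limsup (\<lambda>n. energy s (f n) {a<..<b})" by (rule Liminf_le_Limsup) simp
  also have "\<dots> \<le> (SUP n. energy s (f n) {a<..<b})"
    by (intro Limsup_bounded always_eventually allI SUP_upper) simp
  finally show "energy s u {a<..<b} < \<infinity>" using bdd by (rule order_le_less_trans)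
  have "AE x in lebesgue. \<forall>n. f n x \<in> N" using f_facts(3) by (simp add: AE_all_countable)
  then show "AE x in lebesgue. u x \<in> N"
    using lim by eventually_elim (metis N(1) closed_sequentially)
qed

text \<open>Inside the interval the glued map does not depend on \<open>n\<close>. Across its
  boundary dominated convergence applies: outside the interval \<open>f n\<close> tends to
  \<open>u\<close>, which equals \<open>v\<close> there.\<close>

lemma energy_glue_tendsto:
  assumes I: "a < a'" "a' < b'" "b' < b" and v: "v \<in> HhatN s {a<..<b} N"
    and vu: "AE x in lebesgue. x \<notin> {a'<..<b'} \<longrightarrow> v x = u x"
  shows "(\<lambda>n. energy s (glue {a'<..<b'} v (f n)) {a'<..<b'}) \<longlonglongrightarrow> energy s v {a'<..<b'}"
proof -
  let ?I = "{a'<..<b'}"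
  note v' = HhatND[OF v]
  have "interaction s (glue ?I v (f n)) ?I ?I = interaction s v ?I ?I" for n
    by (intro interaction_cong_AE AE_I2) (auto simp: glue_def)
  moreover have "(\<lambda>n. interaction s (glue ?I v (f n)) ?I (- ?I)) \<longlonglongrightarrow> interaction s v ?I (- ?I)"
  proof (rule interaction_complement_tendsto[OF s I(2)])
    show "glue ?I v (f n) \<in> borel_measurable lebesgue" for n
      using v' f_facts by (intro borel_measurable_glue) auto
    show "v \<in> borel_measurable lebesgue" by (rule v')
    show "AE x in lebesgue. norm (glue ?I v (f n) x) \<le> C" for n
      using AE_bounded[OF N(2) v'(3)] AE_bounded[OF N(2) f_facts(3)[of n]]
      by eventually_elim (auto simp: glue_def)
    show "AE x in lebesgue. (\<lambda>n. glue ?I v (f n) x) \<longlonglongrightarrow> v x"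
      using vu lim
    proof eventually_elim
      case (elim x)
      then show ?case by (cases "x \<in> ?I") (simp_all only: glue_def if_True if_False simp_thms tendsto_const)
    qed
  qed
  ultimately show ?thesis
    unfolding energy_interaction by (auto intro!: tendsto_add ennreal_tendsto_cmult)
qed

text \<open>Comparison with the map glued from \<open>u\<close> bounds the upper limit; lower
  semicontinuity bounds the lower limit.\<close>

lemma energy_tendsto:
  assumes I: "a < a'" "a' < b'" "b' < b"
  shows "(\<lambda>n. energy s (f n) {a'<..<b'}) \<longlonglongrightarrow> energy s u {a'<..<b'}"
proof -
  let ?I = "{a'<..<b'}"
  have "limsup (\<lambda>n. energy s (f n) ?I) \<le> limsup (\<lambda>n. energy s (glue ?I u (f n)) ?I)"
    by (intro Limsup_mono always_eventually allI
        minimizing_s_harmonic_le_glue[OF s N(2) I min limit_HhatN])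
  also have "\<dots> = energy s u ?I"
    by (intro lim_imp_Limsup energy_glue_tendsto[OF I limit_HhatN]) auto
  finally have "limsup (\<lambda>n. energy s (f n) ?I) \<le> energy s u ?I" .
  moreover have "energy s u ?I \<le> liminf (\<lambda>n. energy s (f n) ?I)"
    by (intro energy_le_liminf f_facts u lim) auto
  moreover have "liminf (\<lambda>n. energy s (f n) ?I) \<le> limsup (\<lambda>n. energy s (f n) ?I)"
    by (rule Liminf_le_Limsup) simp
  ultimately show ?thesis by (intro Liminf_eq_Limsup) (auto intro: antisym order_trans)
qed

text \<open>On an inner interval outside which \<open>v\<close> and \<open>u\<close> agree almost
  everywhere, both sides of the comparison of \<open>f n\<close> with its glued competitor converge.
  Adding the remainder of \<open>energy_split\<close>, which is the same for \<open>u\<close> and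
  \<open>v\<close>, gives the inequality on the whole interval.\<close>

lemma limit_minimizing: "minimizing_s_harmonic s {a<..<b} N u"
  unfolding minimizing_s_harmonic_def
proof (intro conjI ballI impI limit_HhatN)
  fix v assume v: "v \<in> HhatN s {a<..<b} N" and "spt (\<lambda>x. v x - u x) \<subseteq> {a<..<b}"
  then obtain a' b' where I: "a < a'" "a' < b'" "b' < b"
    and "AE x in lebesgue. x \<notin> {a'<..<b'} \<longrightarrow> v x - u x = 0"
    using spt_subset_interval[OF _ ab] by blast
  then have vu: "AE x in lebesgue. x \<notin> {a'<..<b'} \<longrightarrow> v x = u x" by simp
  let ?S = "{a<..<b}" and ?I = "{a'<..<b'}"
  have le: "energy s u ?I \<le> energy s v ?I"
    using energy_tendsto[OF I] energy_glue_tendsto[OF I v vu]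
    by (rule LIMSEQ_le) (use minimizing_s_harmonic_le_glue[OF s N(2) I min v] in auto)
  have eq: "interaction s u (?S - ?I) B = interaction s v (?S - ?I) B" if "B \<inter> ?I = {}" for B
    by (rule interaction_cong_AE) (use vu that in \<open>auto elim!: eventually_mono\<close>)
  have D: "interaction s u (?S - ?I) (?S - ?I) = interaction s v (?S - ?I) (?S - ?I)"
    "interaction s u (?S - ?I) (- ?S) = interaction s v (?S - ?I) (- ?S)"
    by (rule eq, use I in auto)+
  have split: "energy s w ?S = energy s w ?I + (ennreal (gamma_s s / 2) * interaction s w (?S - ?I) (?S - ?I)
      + ennreal (gamma_s s) * interaction s w (?S - ?I) (- ?S))" if "w \<in> borel_measurable lebesgue" for w :: "real \<Rightarrow> 'a"
    by (rule energy_split[OF that]) (use I in auto)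
  show "energy s u ?S \<le> energy s v ?S"
    unfolding split[OF u] split[OF HhatND(1)[OF v]] D using le by (rule add_right_mono)
qed

text \<open>The energies converge, and so do their boundary terms; subtracting isolates the double
  integral over the inner square.\<close>

lemma interaction_tendsto:
  assumes I: "a < a'" "a' < b'" "b' < b"
  shows "(\<lambda>n. interaction s (f n) {a'<..<b'} {a'<..<b'}) \<longlonglongrightarrow> interaction s u {a'<..<b'} {a'<..<b'}"
    and "interaction s u {a'<..<b'} {a'<..<b'} < \<infinity>"
proof -
  let ?I = "{a'<..<b'}"
  define c where "c = ennreal (gamma_s s / 2)"
  define B where "B w = ennreal (gamma_s s) * interaction s w ?I (- ?I)" for w :: "real \<Rightarrow> 'a"
  have c: "0 < c" "c < \<infinity>" using gamma_s_pos[OF s] by (auto simp: c_def)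
  have E: "energy s w ?I = c * interaction s w ?I ?I + B w" for w :: "real \<Rightarrow> 'a"
    by (simp add: energy_interaction c_def B_def)
  have fin: "B w < \<infinity>" if "w \<in> HhatN s {a<..<b} N" for w
    using interaction_complement_finite[OF s I(2) AE_bounded[OF N(2) HhatND(3)[OF that]]]
    by (simp add: B_def ennreal_mult_less_top)
  have Blim: "(\<lambda>n. B (f n)) \<longlonglongrightarrow> B u"
    unfolding B_def
    by (intro ennreal_tendsto_cmult interaction_complement_tendsto[OF s I(2), where C = C] f_facts u lim
        AE_bounded[OF N(2) f_facts(3)]) simp
  \<comment> \<open>Solving for the interaction is legitimate because \<open>B w\<close> is finite
    and \<open>c\<close> is neither 0 nor infinite.\<close>
  have eq: "interaction s w ?I ?I = (energy s w ?I - B w) / c" if "w \<in> HhatN s {a<..<b} N" for w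
    using fin[OF that] c by (simp add: E ennreal_mult_divide_eq mult.commute[of c])
  have "energy s u ?I \<le> energy s u {a<..<b}"
    using I by (subst (2) energy_split[OF u, of ?I]) auto
  then have "energy s u ?I < \<infinity>" using HhatND(2)[OF limit_HhatN] by (rule order_le_less_trans)
  then show "interaction s u ?I ?I < \<infinity>" using c by (auto simp: E ennreal_mult_less_top)
  show "(\<lambda>n. interaction s (f n) ?I ?I) \<longlonglongrightarrow> interaction s u ?I ?I"
    unfolding eq[OF f_HhatN] eq[OF limit_HhatN] divide_ennreal_def
    using fin[OF limit_HhatN] c
    by (intro tendsto_mult_ennreal tendsto_const tendsto_diff_ennreal_general
         energy_tendsto I Blim) auto
qed

text \<open>Convergence of the seminorms together with almost everywhere convergence gives strong
  convergence. The moving majorant comes from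
  \<open>norm (p - q) ^ 2 \<le> 2 * norm p ^ 2 + 2 * norm q ^ 2\<close>, and its integrals converge
  by \<open>interaction_tendsto\<close>.\<close>

lemma interaction_diff_tendsto:
  assumes I: "a < a'" "a' < b'" "b' < b"
  shows "(\<lambda>n. interaction s (\<lambda>x. f n x - u x) {a'<..<b'} {a'<..<b'}) \<longlonglongrightarrow> 0"
proof -
  let ?Q = "{a'<..<b'} \<times> {a'<..<b'}"
  let ?G = "\<lambda>w z. frac_integrand s w z * indicator ?Q z"
  have m: "?G w \<in> borel_measurable lebesgue" if "w \<in> borel_measurable lebesgue" for w :: "real \<Rightarrow> 'a"
    by (rule borel_measurable_frac_integrand_indicator[OF that]) auto
  have int: "(\<integral>\<^sup>+ z. 2 * ?G v z + 2 * ?G w z \<partial>lebesgue)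
      = 2 * interaction s v {a'<..<b'} {a'<..<b'} + 2 * interaction s w {a'<..<b'} {a'<..<b'}"
    if "v \<in> borel_measurable lebesgue" "w \<in> borel_measurable lebesgue" for v w :: "real \<Rightarrow> 'a"
    unfolding interaction_def using m[OF that(1)] m[OF that(2)]
    by (simp add: nn_integral_add nn_integral_cmult borel_measurable_times_ennreal del: nn_integral_completion)
  show ?thesis
    unfolding interaction_def
  proof (rule nn_integral_tendsto_0_of_dominated[where
      W = "\<lambda>n z. 2 * ?G (f n) z + 2 * ?G u z" and V = "\<lambda>z. 2 * ?G u z + 2 * ?G u z"])
    show "?G (\<lambda>x. f n x - u x) z \<le> 2 * ?G (f n) z + 2 * ?G u z" for n z
    proof -
      define p q where "p = f n (fst z) - f n (snd z)" and "q = u (fst z) - u (snd z)"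
      have "norm (p - q) ^ 2 \<le> (norm p + norm q) ^ 2" by (intro power_mono norm_triangle_ineq4) auto
      also have "\<dots> \<le> 2 * norm p ^ 2 + 2 * norm q ^ 2"
        using zero_le_power2[of "norm p - norm q"] by (simp add: power2_eq_square algebra_simps)
      finally have "norm (p - q) ^ 2 / t \<le> 2 * (norm p ^ 2 / t) + 2 * (norm q ^ 2 / t)" if "0 \<le> t" for t
        using divide_right_mono[OF _ that] by (fastforce simp: add_divide_distrib)
      then have "ennreal (norm (p - q) ^ 2 / t) \<le> 2 * ennreal (norm p ^ 2 / t) + 2 * ennreal (norm q ^ 2 / t)"
        if "0 \<le> t" for t
        using that by (simp flip: ennreal_numeral ennreal_mult ennreal_plus add: ennreal_leI)
      from this[of "\<bar>fst z - snd z\<bar> powr (1 + 2 * s)"] show ?thesis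
        by (auto simp: frac_integrand_def case_prod_unfold p_def q_def algebra_simps indicator_def)
    qed
    have "AE x in lebesgue. (\<lambda>n. f n x - u x) \<longlonglongrightarrow> 0"
      using lim by eventually_elim (simp add: LIM_zero)
    from frac_integrand_tendsto[OF this, of s]
    show "AE z in lebesgue. (\<lambda>n. ?G (\<lambda>x. f n x - u x) z) \<longlonglongrightarrow> 0"
      by eventually_elim (auto simp: indicator_def frac_integrand_def case_prod_unfold)
    show "AE z in lebesgue. (\<lambda>n. 2 * ?G (f n) z + 2 * ?G u z) \<longlonglongrightarrow> 2 * ?G u z + 2 * ?G u z"
      using frac_integrand_tendsto[OF lim, of s]
      by eventually_elim (auto intro!: tendsto_add ennreal_tendsto_cmult simp: indicator_def)
    show "(\<lambda>n. \<integral>\<^sup>+ z. 2 * ?G (f n) z + 2 * ?G u z \<partial>lebesgue) \<longlonglongrightarrow> (\<integral>\<^sup>+ z. 2 * ?G u z + 2 * ?G u z \<partial>lebesgue)"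
      unfolding int[OF f_facts(1) u] int[OF u u]
      by (intro tendsto_add ennreal_tendsto_cmult interaction_tendsto I tendsto_const) auto
    show "(\<integral>\<^sup>+ z. 2 * ?G u z + 2 * ?G u z \<partial>lebesgue) < \<infinity>"
      unfolding int[OF u u] using interaction_tendsto(2)[OF I] by (simp add: ennreal_mult_less_top)
  qed (use m f_facts(1) u in \<open>auto intro!: borel_measurable_add borel_measurable_times_ennreal borel_measurable_diff
         simp del: measurable_completion\<close>)
qed

end

section \<open>Subsequences and conclusion\<close>

lemma strict_mono_choice:
  assumes "\<And>n :: nat. eventually (P n) sequentially"
  shows "\<exists>r :: nat \<Rightarrow> nat. strict_mono r \<and> (\<forall>n. P n (r n))"
proof -
  have "\<exists>r. \<forall>n. P n (r n) \<and> r n < r (Suc n)"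
  proof (rule dependent_nat_choice)
    show "\<exists>k. P 0 k" using assms[of 0] by (auto simp: eventually_sequentially)
    show "\<exists>l. P (Suc n) l \<and> k < l" for k n
      using eventually_conj[OF assms[of "Suc n"] eventually_gt_at_top[of k]]
      by (auto simp: eventually_sequentially)
  qed
  then show ?thesis by (auto simp: strict_mono_Suc_iff)
qed

text \<open>The \<open>n\<close>-th index is chosen so that the squared distance on
  \<open>{- real n..real n}\<close> is below \<open>(1/2) ^ n\<close>. The sum of the truncated
  squares then has finite integral, so almost everywhere it converges and its terms tend to
  0.\<close>

lemma L2_loc_conv_AE_subseq:
  assumes "L2_loc_conv f u"
  shows "\<exists>r. strict_mono r \<and> (AE x in lebesgue. (\<lambda>n. f (r n) x) \<longlonglongrightarrow> u x)"
proof -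
  let ?g = "\<lambda>k x. norm (f k x - u x) ^ 2"
  have [measurable]: "f n \<in> borel_measurable lebesgue" "u \<in> borel_measurable lebesgue" for n
    using assms by (auto simp: L2_loc_conv_def L2_loc_def)
  have "eventually (\<lambda>k. (\<integral>\<^sup>+ x \<in> {- real n..real n}. ennreal (?g k x) \<partial>lebesgue) < ennreal ((1/2) ^ n)) sequentially" for n
    using assms by (intro order_tendstoD(2)[of _ 0]) (auto simp: L2_loc_conv_def)
  then obtain r :: "nat \<Rightarrow> nat" where r: "strict_mono r"
    and le: "\<And>n. (\<integral>\<^sup>+ x \<in> {- real n..real n}. ennreal (?g (r n) x) \<partial>lebesgue) < ennreal ((1/2) ^ n)"
    using strict_mono_choice[of "\<lambda>n k. (\<integral>\<^sup>+ x \<in> {- real n..real n}. ennreal (?g k x) \<partial>lebesgue) < ennreal ((1/2) ^ n)"]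
    by blast
  let ?h = "\<lambda>n x. ?g (r n) x * indicator {- real n..real n} x"
  have h: "ennreal (?h n x) = ennreal (?g (r n) x) * indicator {- real n..real n} x" for n x
    by (auto simp: indicator_def)
  have hm: "(\<lambda>x. ennreal (?h n x)) \<in> borel_measurable lebesgue" for n
    unfolding h by (intro borel_measurable_times_ennreal borel_measurable_indicator) auto
  have "(\<integral>\<^sup>+ x. (\<Sum>n. ennreal (?h n x)) \<partial>lebesgue) = (\<Sum>n. \<integral>\<^sup>+ x. ennreal (?h n x) \<partial>lebesgue)"
    by (rule nn_integral_suminf) (rule hm)
  also have "\<dots> \<le> (\<Sum>n. ennreal ((1/2) ^ n))"
    unfolding h by (intro suminf_le less_imp_le le) auto
  also have "\<dots> < \<infinity>"
    by (subst suminf_ennreal2) (auto intro: summable_geometric)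
  finally have fin: "(\<integral>\<^sup>+ x. (\<Sum>n. ennreal (?h n x)) \<partial>lebesgue) < \<infinity>" .
  have "(\<lambda>x. \<Sum>n. ennreal (?h n x)) \<in> borel_measurable lebesgue"
    by (rule borel_measurable_suminf_order) (rule hm)
  then have "AE x in lebesgue. (\<Sum>n. ennreal (?h n x)) \<noteq> \<infinity>"
    by (rule nn_integral_PInf_AE) (rule less_imp_neq[OF fin])
  then have "AE x in lebesgue. (\<lambda>n. f (r n) x) \<longlonglongrightarrow> u x"
  proof eventually_elim
    fix x assume "(\<Sum>n. ennreal (?h n x)) \<noteq> \<infinity>"
    then have "summable (\<lambda>n. ?h n x)" by (intro summable_suminf_not_top) auto
    then have "(\<lambda>n. ?h n x) \<longlonglongrightarrow> 0" by (rule summable_LIMSEQ_zero)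
    \<comment> \<open>The truncation disappears at a fixed \<open>x\<close> as soon as
      \<open>n\<close> exceeds its modulus.\<close>
    moreover have "eventually (\<lambda>n. ?h n x = ?g (r n) x) sequentially"
      using eventually_ge_at_top[of "nat \<lceil>\<bar>x\<bar>\<rceil>"] by eventually_elim (auto simp: indicator_def)
    ultimately have "(\<lambda>n. ?g (r n) x) \<longlonglongrightarrow> 0" by (rule Lim_transform_eventually)
    then have "(\<lambda>n. sqrt (?g (r n) x)) \<longlonglongrightarrow> sqrt 0" by (rule tendsto_real_sqrt)
    then show "(\<lambda>n. f (r n) x) \<longlonglongrightarrow> u x" by (simp add: tendsto_norm_zero_iff LIM_zero_iff)
  qed
  with r show ?thesis by blast
qed

text \<open>Almost everywhere convergence is available only along subsequences; this returns the
  conclusions to the whole sequence, as the limit is always the same.\<close>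

lemma tendsto_of_subsubseq:
  fixes X :: "nat \<Rightarrow> 'b::topological_space"
  assumes "\<And>r :: nat \<Rightarrow> nat. strict_mono r \<Longrightarrow> \<exists>r'. strict_mono r' \<and> (\<lambda>n. X (r (r' n))) \<longlonglongrightarrow> L"
  shows "X \<longlonglongrightarrow> L"
proof (rule ccontr)
  assume "\<not> X \<longlonglongrightarrow> L"
  then obtain S where S: "open S" "L \<in> S" "\<not> eventually (\<lambda>n. X n \<in> S) sequentially"
    by (auto simp: tendsto_def)
  then have "infinite {n. X n \<notin> S}" by (simp add: eventually_cofinite flip: cofinite_eq_sequentially)
  then obtain r :: "nat \<Rightarrow> nat" where r: "strict_mono r" "\<And>n. X (r n) \<notin> S"
    using infinite_enumerate by blast
  then obtain r' where "(\<lambda>n. X (r (r' n))) \<longlonglongrightarrow> L" using assms by blast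
  then have "eventually (\<lambda>n. X (r (r' n)) \<in> S) sequentially" using S by (auto dest: topological_tendstoD)
  with r(2) show False by simp
qed

theorem theorem4p1:
  fixes s :: real and N :: "'a::euclidean_space set" and a b :: real
    and f :: "nat \<Rightarrow> real \<Rightarrow> 'a" and u :: "real \<Rightarrow> 'a"
  assumes "0 < s" "s < 1/2"
    and "compact N" "smooth_submanifold N"
    and "a < b"
    and "\<And>n. minimizing_s_harmonic s {a<..<b} N (f n)"
    and "(SUP n. energy s (f n) {a<..<b}) < \<infinity>"
    and "L2_loc_conv f u"
  shows "u \<in> HhatN s {a<..<b} N \<and> minimizing_s_harmonic s {a<..<b} N u
    \<and> (\<forall>a' b'. a < a' \<and> a' < b' \<and> b' < b \<longrightarrow>
          ((\<lambda>n. Hs_norm_sq s {a'<..<b'} (\<lambda>x. f n x - u x)) \<longlonglongrightarrow> 0))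
    \<and> (\<forall>a' b'. a < a' \<and> a' < b' \<and> b' < b \<longrightarrow>
          ((\<lambda>n. energy s (f n) {a'<..<b'}) \<longlonglongrightarrow> energy s u {a'<..<b'}))"
proof -
  obtain C where C: "\<forall>x\<in>N. norm x \<le> C"
    using compact_imp_bounded[OF assms(3)] by (auto simp: bounded_iff)
  have u: "u \<in> borel_measurable lebesgue" using assms(8) by (simp add: L2_loc_conv_def L2_loc_def)
  have SUP: "(SUP n. energy s (f (r n)) {a<..<b}) < \<infinity>" for r :: "nat \<Rightarrow> nat"
    by (rule order_le_less_trans[OF _ assms(7)]) (intro SUP_least SUP_upper UNIV_I)
  have sub: "\<exists>r'. strict_mono r' \<and> (AE x in lebesgue. (\<lambda>n. f (r (r' n)) x) \<longlonglongrightarrow> u x)"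
    if "strict_mono r" for r :: "nat \<Rightarrow> nat"
  proof (rule L2_loc_conv_AE_subseq)
    show "L2_loc_conv (\<lambda>n. f (r n)) u"
      unfolding L2_loc_conv_def
    proof (intro conjI allI)
      fix a b
      have "(\<lambda>n. \<integral>\<^sup>+ x \<in> {a..b}. ennreal (norm (f n x - u x) ^ 2) \<partial>lebesgue) \<longlonglongrightarrow> 0"
        using assms(8) unfolding L2_loc_conv_def by blast
      then show "(\<lambda>n. \<integral>\<^sup>+ x \<in> {a..b}. ennreal (norm (f (r n) x - u x) ^ 2) \<partial>lebesgue) \<longlonglongrightarrow> 0"
        by (rule filterlim_compose[OF _ filterlim_subseq[OF that]])
    qed (use assms(8) in \<open>auto simp: L2_loc_conv_def\<close>)
  qed
  note closed = compact_imp_closed[OF assms(3)]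
  \<comment> \<open>Membership and minimality concern only \<open>u\<close>, so a single subsequence
    suffices for them.\<close>
  obtain r where r: "AE x in lebesgue. (\<lambda>n. f (r n) x) \<longlonglongrightarrow> u x"
    using L2_loc_conv_AE_subseq[OF assms(8)] by blast
  show ?thesis
  proof (intro conjI allI impI; (elim conjE)?)
    show "u \<in> HhatN s {a<..<b} N"
      by (rule limit_HhatN[OF assms(1,2,5) closed C assms(6) SUP u r])
    show "minimizing_s_harmonic s {a<..<b} N u"
      by (rule limit_minimizing[OF assms(1,2,5) closed C assms(6) SUP u r])
    fix a' b' assume I: "a < a'" "a' < b'" "b' < b"
    show "(\<lambda>n. energy s (f n) {a'<..<b'}) \<longlonglongrightarrow> energy s u {a'<..<b'}"
    proof (rule tendsto_of_subsubseq)
      fix r :: "nat \<Rightarrow> nat" assume "strict_mono r"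
      from sub[OF this] obtain r' where r': "strict_mono r'"
        "AE x in lebesgue. (\<lambda>n. f (r (r' n)) x) \<longlonglongrightarrow> u x" by blast
      have "(\<lambda>n. energy s (f (r (r' n))) {a'<..<b'}) \<longlonglongrightarrow> energy s u {a'<..<b'}"
        by (rule energy_tendsto[OF assms(1,2,5) closed C assms(6) SUP u r'(2) I])
      with r'(1) show "\<exists>r'. strict_mono r' \<and> (\<lambda>n. energy s (f (r (r' n))) {a'<..<b'}) \<longlonglongrightarrow> energy s u {a'<..<b'}"
        by (intro exI conjI)
    qed
  next
    fix a' b' assume I: "a < a'" "a' < b'" "b' < b"
    have "(\<lambda>n. interaction s (\<lambda>x. f n x - u x) {a'<..<b'} {a'<..<b'}) \<longlonglongrightarrow> 0"
    proof (rule tendsto_of_subsubseq)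
      fix r :: "nat \<Rightarrow> nat" assume "strict_mono r"
      from sub[OF this] obtain r' where r': "strict_mono r'"
        "AE x in lebesgue. (\<lambda>n. f (r (r' n)) x) \<longlonglongrightarrow> u x" by blast
      have "(\<lambda>n. interaction s (\<lambda>x. f (r (r' n)) x - u x) {a'<..<b'} {a'<..<b'}) \<longlonglongrightarrow> 0"
        by (rule interaction_diff_tendsto[OF assms(1,2,5) closed C assms(6) SUP u r'(2) I])
      with r'(1) show "\<exists>r'. strict_mono r' \<and> (\<lambda>n. interaction s (\<lambda>x. f (r (r' n)) x - u x) {a'<..<b'} {a'<..<b'}) \<longlonglongrightarrow> 0"
        by (intro exI conjI)
    qed
    \<comment> \<open>This part of the norm converges along the whole sequence by hypothesis; only
      the seminorm required subsequences.\<close>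
    moreover have "(\<lambda>n. \<integral>\<^sup>+ x \<in> {a'<..<b'}. ennreal (norm (f n x - u x) ^ 2) \<partial>lebesgue) \<longlonglongrightarrow> 0"
    proof (rule tendsto_sandwich[OF _ _ tendsto_const])
      show "(\<lambda>n. \<integral>\<^sup>+ x \<in> {a'..b'}. ennreal (norm (f n x - u x) ^ 2) \<partial>lebesgue) \<longlonglongrightarrow> 0"
        using assms(8) by (simp add: L2_loc_conv_def)
    qed (auto intro!: always_eventually nn_integral_mono split: split_indicator simp del: nn_integral_completion)
    ultimately show "(\<lambda>n. Hs_norm_sq s {a'<..<b'} (\<lambda>x. f n x - u x)) \<longlonglongrightarrow> 0"
      unfolding Hs_norm_sq_def interaction_def[symmetric] using tendsto_add by force
  qed
qed

end
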